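(* Let $\mathcal{C}_1,\mathcal{C}_2\subset\mathbb{R}^2$ be real plane algebraic curves defined by real irreducible polynomials $f,g$ of the same degree $n$ with rational coefficients, each curve containing infinitely many real points and being neither a line nor a circle. Let $F(z,\bar z)$ and $G(z,\bar z)$ be their complex implicit equations. Let $\boldsymbol{a},\boldsymbol{b}\in\mathbb{C}$ with $\boldsymbol{a}\neq 0$. (i) The curves are related by the orientation-preserving similarity $h(z)=\boldsymbol{a}z+\boldsymbol{b}$, i.e. $h(\mathcal{C}_1)=\mathcal{C}_2$, if and only if there exists $\lambda\in\mathbb{C}$, $\lambda\neq 0$, such that $$G(\boldsymbol{a}z+\boldsymbol{b},\ \overline{\boldsymbol{a}}\bar z+\overline{\boldsymbol{b}})=\lambda\cdot F(z,\bar z)\quad\text{for all } z\in\mathbb{C}.$$ (ii) The curves are related by the orientation-reversing similarity $h(z)=\boldsymbol{a}\bar z+\boldsymbol{b}$, i.e. $h(\mathcal{C}_1)=\mathcal{C}_2$, if and only if there exists $\lambda\in\mathbb{C}$ such that $$G(\boldsymbol{a}\bar z+\boldsymbol{b},\ \overline{\boldsymbol{a}}z+\overline{\boldsymbol{b}})=\lambda\cdot F(z,\bar z)\quad\text{for all } z\in\mathbb{C}.$$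
   Context: The plane $\mathbb{R}^2$ is identified with $\mathbb{C}$ via $(x,y)\simeq z=x+iy$. The curve $\mathcal{C}_1$ is the real zero set of $f(x,y)$ and $\mathcal{C}_2$ that of $g(x,y)$; irreducible means irreducible in $\mathbb{R}[x,y]$. The complex implicit equation of $\mathcal{C}_1$ is the polynomial $F(z,\bar z)=f\left(\frac{z+\bar z}{2},\frac{z-\bar z}{2i}\right)$ in $z,\bar z$; likewise $G(z,\bar z)=g\left(\frac{z+\bar z}{2},\frac{z-\bar z}{2i}\right)$ for $\mathcal{C}_2$. A similarity of the plane is an affine map that multiplies all Euclidean distances by a fixed ratio $r>0$; in complex form the orientation-preserving ones are $z\mapsto \boldsymbol{a}z+\boldsymbol{b}$ and the orientation-reversing ones are $z\mapsto\boldsymbol{a}\bar z+\boldsymbol{b}$, with $\boldsymbol{a},\boldsymbol{b}\in\mathbb{C}$, $\boldsymbol{a}\ne0$ (and ratio $|\boldsymbol{a}|$). *)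

theory Defs
  imports "HOL-Analysis.Analysis" "HOL-Computational_Algebra.Computational_Algebra"
begin

text \<open>
  A bivariate polynomial in $x, y$ over a ring \<open>R\<close> is an element of $R[x][y]$, i.e. of type
  \<open>'a poly poly\<close>: the inner variable is the first one (\<open>x\<close>, or \<open>z\<close> for complex implicit equations),
  the outer variable is the second one (\<open>y\<close>, or the conjugate of \<open>z\<close>). So the coefficient of
  $x^i y^j$ in \<open>p\<close> is \<open>coeff (coeff p j) i\<close>.
\<close>

definition poly2 :: "'a::comm_ring_1 poly poly \<Rightarrow> 'a \<Rightarrow> 'a \<Rightarrow> 'a" where
  "poly2 p x y = poly (poly p [:y:]) x"

text \<open>The zero polynomial gets total degree 0.\<close>

definition total_degree :: "'a::zero poly poly \<Rightarrow> nat" where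
  "total_degree p = Max (insert 0 {i + j |i j. coeff (coeff p j) i \<noteq> 0})"

definition rational_coeffs :: "real poly poly \<Rightarrow> bool" where
  "rational_coeffs p \<longleftrightarrow> (\<forall>i j. coeff (coeff p j) i \<in> \<rat>)"

text \<open>Real zero set, as a subset of the plane identified with the complex numbers.\<close>

definition real_curve :: "real poly poly \<Rightarrow> complex set" where
  "real_curve f = {z. poly2 f (Re z) (Im z) = 0}"

definition is_line :: "complex set \<Rightarrow> bool" where
  "is_line S \<longleftrightarrow> affine S \<and> aff_dim S = 1"

definition is_circle :: "complex set \<Rightarrow> bool" where
  "is_circle S \<longleftrightarrow> (\<exists>c r. r > 0 \<and> S = sphere c r)"

text \<open>
  The polynomial $F(z,w) = f((z+w)/2, (z-w)/(2i))$ in two independent variables: \<open>f\<close> is viewed as a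
  polynomial with coefficients in the ring $\mathbb{C}[z][w]$ and evaluated at the two elements
  $z/2 + w/2$ and $z/(2i) - w/(2i)$ of that ring. The second variable stands for the
  conjugate of \<open>z\<close>.
\<close>

definition complex_implicit :: "real poly poly \<Rightarrow> complex poly poly" where
  "complex_implicit f =
     poly2 (map_poly (map_poly (\<lambda>c. [:[:complex_of_real c:]:])) f)
       [:[:0, 1 / 2:], [:1 / 2:]:]
       [:[:0, 1 / (2 * \<i>):], [:- 1 / (2 * \<i>):]:]"

lemma poly2_simps [simp]:
  "poly2 0 x y = 0"
  "poly2 (pCons q p) x y = poly q x + y * poly2 p x y"
  "poly2 (p + p') x y = poly2 p x y + poly2 p' x y"
  "poly2 (p * p') x y = poly2 p x y * poly2 p' x y"
  "poly2 (smult q p) x y = poly q x * poly2 p x y"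
  by (simp_all add: poly2_def)

lemma complex_implicit_eval:
  "poly2 (complex_implicit f) z w =
     poly2 (map_poly (map_poly complex_of_real) f) ((z + w) / 2) ((z - w) / (2 * \<i>))"
proof -
  have inner: "poly2 (poly (map_poly (\<lambda>c. [:[:complex_of_real c:]:]) q)
        [:[:0, 1 / 2:], [:1 / 2:]:]) z w = poly (map_poly complex_of_real q) ((z + w) / 2)" for q
    by (induction q) (auto simp: map_poly_pCons field_simps)
  show ?thesis
    unfolding complex_implicit_def
    by (induction f) (auto simp: map_poly_pCons inner field_simps)
qed

text \<open>On pairs of conjugate arguments the complex implicit equation has the values of \<open>f\<close>.\<close>

lemma complex_implicit_cnj:
  "poly2 (complex_implicit f) z (cnj z) = complex_of_real (poly2 f (Re z) (Im z))"
proof -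
  have xy: "(z + cnj z) / 2 = complex_of_real (Re z)" "(z - cnj z) / (2 * \<i>) = complex_of_real (Im z)"
    by (auto simp: complex_eq_iff complex_add_cnj complex_diff_cnj)
  have inner: "poly (map_poly complex_of_real q) (of_real x) = of_real (poly q x)" for q x
    by (induction q) (auto simp: map_poly_pCons)
  show ?thesis
    unfolding complex_implicit_eval xy
    by (induction f) (auto simp: map_poly_pCons inner)
qed

end

theory Submission
  imports Defs "HOL-Computational_Algebra.Field_as_Ring"
begin

text \<open>
  A similarity is a real affine bijection of the plane, so \<open>g \<circ> h\<close> is a real polynomial of total
  degree at most that of \<open>g\<close>. If it vanishes on the infinite zero set of the irreducible
  polynomial \<open>f\<close>, then \<open>f\<close> divides it: otherwise Bezout's identity over $\mathbb{R}(x)$ would bound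
  the abscissae of the common zeros, and vertical lines contribute only finitely many points.
  As the total degrees agree, the quotient is a constant.
\<close>

section \<open>Common zeros of bivariate polynomials\<close>

text \<open>
  Bezout's identity over the fraction field with denominators cleared; the generator of the
  ideal is found as an element of least degree, using pseudo-division.
\<close>

lemma bezout_up_to_constant:
  fixes f h :: "'a::idom poly"
  assumes f: "prime_elem f" and fh: "\<not> f dvd h"
  shows "\<exists>u v d. d \<noteq> 0 \<and> u * f + v * h = [:d:]"
proof -
  define I where "I = {p. p \<noteq> 0 \<and> (\<exists>u v. p = u * f + v * h)}"
  have "f \<noteq> 0" using f by auto
  moreover have "f = 1 * f + 0 * h" by simp
  ultimately have "f \<in> I" unfolding I_def by blast
  then obtain p where p: "p \<in> I" and min: "\<And>q. q \<in> I \<Longrightarrow> degree p \<le> degree q"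
    using ex_has_least_nat[of "\<lambda>p. p \<in> I" f degree] by blast
  from p obtain u v where p0: "p \<noteq> 0" and uv: "p = u * f + v * h" by (auto simp: I_def)
  \<comment> \<open>The pseudo-remainder of \<open>k\<close> by \<open>p\<close> is again a
    combination of \<open>f\<close> and \<open>h\<close>, and is zero or of smaller degree than
    \<open>p\<close>; minimality forces it to vanish.\<close>
  have divides: "\<exists>a q. a \<noteq> 0 \<and> smult a k = p * q" if k: "k = s * f + t * h" for k s t
  proof -
    obtain a q where a: "a \<noteq> 0" and q: "smult a k = p * q + pseudo_mod k p"
      using pseudo_mod(1)[OF p0] by blast
    have "pseudo_mod k p = smult a (s * f + t * h) - (u * f + v * h) * q"
      using q k uv by (simp add: algebra_simps)
    also have "\<dots> = (smult a s - u * q) * f + (smult a t - v * q) * h"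
      by (simp add: algebra_simps smult_add_right)
    finally have "pseudo_mod k p = 0 \<or> pseudo_mod k p \<in> I"
      unfolding I_def by blast
    with min pseudo_mod(2)[OF p0, of k] have "pseudo_mod k p = 0"
      by (meson not_le)
    with a q show ?thesis by auto
  qed
  have "f = 1 * f + 0 * h" "h = 0 * f + 1 * h" by simp_all
  with divides obtain a q b r where a: "a \<noteq> 0" "smult a f = p * q" and b: "b \<noteq> 0" "smult b h = p * r"
    by meson
  \<comment> \<open>Since \<open>f\<close> is prime, it divides \<open>p\<close> or the cofactor
    \<open>q\<close>. In the first case it divides \<open>[:b:] * h\<close>, hence
    \<open>[:b:]\<close>, so \<open>f\<close> has degree 0 and by minimality so has
    \<open>p\<close>. In the second, cancelling \<open>f\<close> makes \<open>p\<close> a divisor of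
    \<open>[:a:]\<close>.\<close>
  have "degree p = 0"
  proof (cases "f dvd p")
    case True
    hence "f dvd [:b:] * h" using b by simp
    with f fh have "f dvd [:b:]" using prime_elem_dvd_multD by blast
    with b have "degree f = 0"
      by (metis degree_pCons_0 dvd_imp_degree_le le_zero_eq pCons_eq_0_iff)
    with min[OF \<open>f \<in> I\<close>] show ?thesis by simp
  next
    case False
    have "f dvd p * q" using a by (metis dvd_refl dvd_smult)
    with False f have "f dvd q" using prime_elem_dvd_multD by blast
    then obtain s where "q = f * s" by auto
    with a have "f * [:a:] = f * (p * s)" by (simp add: mult_ac)
    with \<open>f \<noteq> 0\<close> have "[:a:] = p * s" by (metis mult_cancel_left)
    with a show ?thesis
      by (metis degree_pCons_0 dvd_imp_degree_le dvd_triv_left le_zero_eq pCons_eq_0_iff)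
  qed
  then obtain d where "p = [:d:]" by (metis degree_eq_zeroE)
  with p0 uv have "d \<noteq> 0" "u * f + v * h = [:d:]" by auto
  thus ?thesis by blast
qed

text \<open>Fixing the abscissa leaves a univariate polynomial in y with infinitely many roots. All
  its coefficients vanish, so every coefficient of \<open>p\<close> has the root
  \<open>x\<close>.\<close>

lemma linear_dvd_of_infinite_fibre:
  fixes p :: "'a::idom poly poly"
  assumes "infinite {y. poly2 p x y = 0}"
  shows "[:[:-x, 1:]:] dvd p"
proof -
  have "poly2 p x y = poly (map_poly (\<lambda>q. poly q x) p) y" for y
    by (induction p) (auto simp: map_poly_pCons)
  with assms have "map_poly (\<lambda>q. poly q x) p = 0"
    using poly_roots_finite by fastforce
  hence "poly (coeff p n) x = 0" for n
    by (metis coeff_0 coeff_map_poly poly_0)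
  thus ?thesis by (simp add: const_poly_dvd_iff poly_eq_0_iff_dvd)
qed

lemma irreducible_dvd_if_infinite_common_zeros:
  fixes f h :: "'a::field_gcd poly poly"
  assumes f: "irreducible f"
    and inf: "infinite {(x, y). poly2 f x y = 0 \<and> poly2 h x y = 0}"
  shows "f dvd h"
proof (rule ccontr)
  assume fh: "\<not> f dvd h"
  \<comment> \<open>Factorization in \<open>'a poly poly\<close> is unique, so irreducible elements
    are prime.\<close>
  have "prime_elem f" using f by (rule irreducible_imp_prime_elem)
  from bezout_up_to_constant[OF this fh] obtain u v d
    where d: "d \<noteq> 0" and uv: "u * f + v * h = [:d:]" by blast
  have abscissa: "poly d x = 0" if "poly2 f x y = 0" "poly2 h x y = 0" for x y
  proof -
    have "poly2 [:d:] x y = 0" unfolding uv[symmetric] using that by simp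
    thus ?thesis by simp
  qed
  \<comment> \<open>An infinite fibre makes the equation of the vertical line divide both
    \<open>f\<close> and \<open>h\<close>. Being a non-unit divisor of the irreducible
    \<open>f\<close>, it is associated to \<open>f\<close>, so \<open>f\<close> would divide
    \<open>h\<close>.\<close>
  have fibre: "finite {y. poly2 f x y = 0 \<and> poly2 h x y = 0}" for x
  proof (rule ccontr)
    assume inf: "infinite {y. poly2 f x y = 0 \<and> poly2 h x y = 0}"
    hence "infinite {y. poly2 f x y = 0}" "infinite {y. poly2 h x y = 0}"
      by (auto elim: contrapos_nn[rotated] intro: finite_subset[rotated])
    hence "[:[:-x, 1:]:] dvd f" and h: "[:[:-x, 1:]:] dvd h"
      by (auto intro: linear_dvd_of_infinite_fibre)
    moreover have "\<not> [:[:-x, 1:]:] dvd 1"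
      by (simp add: is_unit_const_poly_iff is_unit_poly_iff)
    ultimately have "f dvd [:[:-x, 1:]:]" using irreducibleD'[OF f] by blast
    with h fh show False using dvd_trans by blast
  qed
  have "{(x, y). poly2 f x y = 0 \<and> poly2 h x y = 0}
      \<subseteq> Sigma {x. poly d x = 0} (\<lambda>x. {y. poly2 f x y = 0 \<and> poly2 h x y = 0})"
    using abscissa by auto
  moreover have "finite (Sigma {x. poly d x = 0} (\<lambda>x. {y. poly2 f x y = 0 \<and> poly2 h x y = 0}))"
    using fibre poly_roots_finite[OF d] by blast
  ultimately show False using inf finite_subset by blast
qed

text \<open>A polynomial over the domain \<open>'a poly\<close> is determined by its values at
  infinitely many points, here the constants \<open>[:y:]\<close>. Polynomial identities can thus be
  checked pointwise.\<close>

lemma poly2_eq_iff: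
  fixes p q :: "'a::{idom,ring_char_0} poly poly"
  shows "p = q \<longleftrightarrow> (\<forall>x y. poly2 p x y = poly2 q x y)"
proof
  assume eq: "\<forall>x y. poly2 p x y = poly2 q x y"
  have "poly p [:y:] = poly q [:y:]" for y
    using eq by (auto simp: poly2_def poly_eq_poly_eq_iff[symmetric])
  hence "range (\<lambda>y. [:y:]) \<subseteq> {w. poly (p - q) w = 0}" by auto
  moreover have "infinite (range (\<lambda>y::'a. [:y:]))"
    by (subst finite_image_iff) (auto simp: inj_on_def infinite_UNIV_char_0)
  ultimately have "p - q = 0" using poly_roots_finite[of "p - q"] finite_subset by blast
  thus "p = q" by simp
qed auto

section \<open>Substitution and total degree\<close>

text \<open>Coefficients are lifted to constants of \<open>'a poly poly\<close>, so that
  \<open>poly2\<close> can evaluate in that ring, as in \<open>complex_implicit\<close>.\<close>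

definition subst2 :: "'a::comm_ring_1 poly poly \<Rightarrow> 'a poly poly \<Rightarrow> 'a poly poly \<Rightarrow> 'a poly poly" where
  "subst2 p X Y = poly2 (map_poly (map_poly (\<lambda>c. [:[:c:]:])) p) X Y"

lemma poly2_subst2: "poly2 (subst2 p X Y) x y = poly2 p (poly2 X x y) (poly2 Y x y)"
proof -
  have "poly2 (poly (map_poly (\<lambda>c. [:[:c:]:]) q) X) x y = poly q (poly2 X x y)" for q
    by (induction q) (auto simp: map_poly_pCons)
  thus ?thesis unfolding subst2_def by (induction p) (auto simp: map_poly_pCons)
qed

text \<open>
  The polynomial $p(xt, t)$ in the variables \<open>x\<close> (inner) and \<open>t\<close> (outer). The monomials of $p$
  of total degree $k$ become the distinct monomials of the coefficient of $t^k$.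
\<close>

definition graded :: "'a::comm_ring_1 poly poly \<Rightarrow> 'a poly poly" where
  "graded p = subst2 p [:0, [:0, 1:]:] [:0, 1:]"

lemma coeff_graded:
  "coeff (coeff (graded p) k) i = (if i \<le> k then coeff (coeff p (k - i)) i else 0)"
proof -
  have inner: "coeff (coeff (poly (map_poly (\<lambda>c. [:[:c:]:]) q) [:0, [:0, 1:]:]) k) i
      = (if i = k then coeff q i else 0)" for q :: "'a poly" and k i
  proof (induction q arbitrary: k i)
    case (pCons c q)
    show ?case by (auto simp: map_poly_pCons pCons coeff_pCons split: nat.splits)
  qed simp
  show ?thesis unfolding graded_def subst2_def
  proof (induction p arbitrary: k i)
    case (pCons q p)
    show ?case by (auto simp: map_poly_pCons pCons inner coeff_pCons Suc_diff_le split: nat.splits)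
  qed simp
qed

lemma degree_le_iff_coeff: "degree p \<le> n \<longleftrightarrow> (\<forall>k>n. coeff p k = 0)"
  by (meson coeff_eq_0 degree_le order.strict_trans1)

lemma degree_graded_le_iff:
  "degree (graded p) \<le> n \<longleftrightarrow> (\<forall>i j. coeff (coeff p j) i \<noteq> 0 \<longrightarrow> i + j \<le> n)"
proof -
  have "degree (graded p) \<le> n \<longleftrightarrow> (\<forall>k>n. \<forall>i\<le>k. coeff (coeff p (k - i)) i = 0)"
    by (auto simp: degree_le_iff_coeff poly_eq_iff coeff_graded)
  also have "\<dots> \<longleftrightarrow> (\<forall>i j. coeff (coeff p j) i \<noteq> 0 \<longrightarrow> i + j \<le> n)"
    by (metis add_diff_cancel_left' le_add1 le_add_diff_inverse not_le)
  finally show ?thesis .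
qed

text \<open>The occurring exponents are bounded by the degrees of \<open>p\<close> and of its
  coefficients, so \<open>Max\<close> is taken over a finite set.\<close>

lemma total_degree_le_iff:
  "total_degree p \<le> n \<longleftrightarrow> (\<forall>i j. coeff (coeff p j) i \<noteq> 0 \<longrightarrow> i + j \<le> n)"
proof -
  let ?S = "{i + j |i j. coeff (coeff p j) i \<noteq> 0}"
  have "?S \<subseteq> (\<lambda>(i, j). i + j) ` (Sigma {..degree p} (\<lambda>j. {..degree (coeff p j)}))"
  proof safe
    fix i j assume c: "coeff (coeff p j) i \<noteq> 0"
    hence "coeff p j \<noteq> 0" by auto
    with c have "(j, i) \<in> Sigma {..degree p} (\<lambda>j. {..degree (coeff p j)})"
      by (auto intro: le_degree)
    thus "i + j \<in> (\<lambda>(i, j). i + j) ` (Sigma {..degree p} (\<lambda>j. {..degree (coeff p j)}))"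
      by (metis (no_types, lifting) add.commute case_prod_conv image_eqI)
  qed
  hence "finite ?S" by (rule finite_subset) auto
  thus ?thesis unfolding total_degree_def by (subst Max_le_iff) auto
qed

text \<open>Both sides have the same upper bounds. Rules for the ordinary degree in t, such as
  additivity on products, thereby carry over to the total degree.\<close>

lemma total_degree_eq_degree_graded: "total_degree p = degree (graded p)"
  by (metis degree_graded_le_iff total_degree_le_iff order.antisym order.refl)

lemma graded_add:
  fixes p q :: "'a::{idom,ring_char_0} poly poly"
  shows "graded (p + q) = graded p + graded q"
  by (simp add: poly2_eq_iff graded_def poly2_subst2)

lemma graded_mult:
  fixes p q :: "'a::{idom,ring_char_0} poly poly"
  shows "graded (p * q) = graded p * graded q"
  by (simp add: poly2_eq_iff graded_def poly2_subst2)

lemma graded_eq_0_iff [simp]: "graded p = 0 \<longleftrightarrow> p = 0"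
proof
  assume "graded p = 0"
  hence "coeff (coeff p j) i = 0" for i j
    using coeff_graded[of p "i + j" i] by simp
  thus "p = 0" by (simp add: poly_eq_iff)
qed (simp add: graded_def subst2_def)

lemma total_degree_mult:
  fixes p q :: "'a::{idom,ring_char_0} poly poly"
  assumes "p \<noteq> 0" "q \<noteq> 0"
  shows "total_degree (p * q) = total_degree p + total_degree q"
  using assms by (simp add: total_degree_eq_degree_graded graded_mult degree_mult_eq)

lemma total_degree_mult_le:
  fixes p q :: "'a::{idom,ring_char_0} poly poly"
  shows "total_degree (p * q) \<le> total_degree p + total_degree q"
  by (simp add: total_degree_eq_degree_graded graded_mult degree_mult_le)

lemma total_degree_add_le:
  fixes p q :: "'a::{idom,ring_char_0} poly poly"
  assumes "total_degree p \<le> n" "total_degree q \<le> n"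
  shows "total_degree (p + q) \<le> n"
  using assms by (simp add: total_degree_eq_degree_graded graded_add degree_add_le)

lemma total_degree_0_iff: "total_degree p = 0 \<longleftrightarrow> (\<exists>c. p = [:[:c:]:])"
proof
  assume "total_degree p = 0"
  hence "coeff (coeff p j) i = 0" if "i + j \<noteq> 0" for i j
    using that total_degree_le_iff[of p 0] by auto
  hence "p = [:[:coeff (coeff p 0) 0:]:]"
    by (auto simp: poly_eq_iff coeff_pCons split: nat.splits)
  thus "\<exists>c. p = [:[:c:]:]" ..
next
  assume "\<exists>c. p = [:[:c:]:]"
  then obtain c where "p = [:[:c:]:]" ..
  hence "total_degree p \<le> 0"
    by (subst total_degree_le_iff) (auto simp: coeff_pCons split: nat.splits)
  thus "total_degree p = 0" by simp
qed

text \<open>Induction along Horner's scheme, first in x and then in y: each multiplication by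
  \<open>X\<close> or \<open>Y\<close> raises the bound by at most one, while the exponents in the
  tail of the polynomial are one lower.\<close>

lemma total_degree_subst2_affine:
  fixes p :: "'a::{idom,ring_char_0} poly poly"
  assumes X: "total_degree X \<le> 1" and Y: "total_degree Y \<le> 1"
  shows "total_degree (subst2 p X Y) \<le> total_degree p"
proof -
  have product: "total_degree (Z * q) \<le> Suc n"
    if "total_degree Z \<le> 1" "total_degree q \<le> n" for Z q :: "'a poly poly" and n
    using total_degree_mult_le[of Z q] that by linarith
  have const: "total_degree [:[:c:]:] \<le> n" for c :: 'a and n
    using total_degree_0_iff[of "[:[:c:]:]"] by auto
  have inner: "total_degree (poly (map_poly (\<lambda>c. [:[:c:]:]) q) X) \<le> n"
    if "\<forall>i. coeff q i \<noteq> 0 \<longrightarrow> i \<le> n" for q n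
    using that
  proof (induction q arbitrary: n)
    case 0
    show ?case using const[of 0 n] by simp
  next
    case (pCons c q)
    show ?case
    proof (cases "q = 0")
      case True
      thus ?thesis using const[of c n] by (simp add: map_poly_pCons)
    next
      case False
      \<comment> \<open>A nonzero tail forces \<open>n\<close> to be positive, so the bound can be
        lowered for the induction hypothesis.\<close>
      hence "Suc (degree q) \<le> n" using pCons.prems by (metis coeff_pCons_Suc leading_coeff_0_iff)
      then obtain m where m: "n = Suc m" by (cases n) auto
      have "\<forall>i. coeff q i \<noteq> 0 \<longrightarrow> i \<le> m"
        using pCons.prems m by (metis Suc_le_mono coeff_pCons_Suc)
      from pCons.IH[OF this] have "total_degree (X * poly (map_poly (\<lambda>c. [:[:c:]:]) q) X) \<le> n"
        using product X m by blast
      thus ?thesis using const[of c n] by (simp add: map_poly_pCons total_degree_add_le)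
    qed
  qed
  have "total_degree (subst2 p X Y) \<le> n"
    if "\<forall>i j. coeff (coeff p j) i \<noteq> 0 \<longrightarrow> i + j \<le> n" for n
    using that unfolding subst2_def
  proof (induction p arbitrary: n)
    case 0
    show ?case using const[of 0 n] by simp
  next
    case (pCons q p)
    have "\<forall>i. coeff q i \<noteq> 0 \<longrightarrow> i \<le> n"
      using pCons.prems by (metis add.right_neutral coeff_pCons_0)
    hence q: "total_degree (poly (map_poly (\<lambda>c. [:[:c:]:]) q) X) \<le> n" by (rule inner)
    show ?case
    proof (cases "p = 0")
      case True
      thus ?thesis using q by (simp add: map_poly_pCons)
    next
      case False
      then obtain i j where "coeff (coeff p j) i \<noteq> 0" by (metis leading_coeff_0_iff)
      hence "i + Suc j \<le> n" using pCons.prems by (metis coeff_pCons_Suc)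
      then obtain m where m: "n = Suc m" by (cases n) auto
      have "\<forall>i j. coeff (coeff p j) i \<noteq> 0 \<longrightarrow> i + j \<le> m"
        using pCons.prems m by (metis Suc_le_mono add_Suc_right coeff_pCons_Suc)
      from pCons.IH[OF this]
      have "total_degree (Y * poly2 (map_poly (map_poly (\<lambda>c. [:[:c:]:])) p) X Y) \<le> n"
        using product Y m by blast
      thus ?thesis using q by (simp add: map_poly_pCons total_degree_add_le)
    qed
  qed
  thus ?thesis using total_degree_le_iff by blast
qed

section \<open>Curves related by affine maps\<close>

text \<open>With multiplier 0, surjectivity of \<open>h\<close> would make \<open>g\<close> vanish
  on the whole plane. This is why the condition on the multiplier can be stated in one part of the
  theorem and omitted in the other.\<close>

lemma nonzero_multiplier:
  fixes f g :: "real poly poly" and h :: "complex \<Rightarrow> complex"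
  assumes g: "g \<noteq> 0" and h: "surj h"
    and l: "\<And>z. complex_of_real (poly2 g (Re (h z)) (Im (h z)))
      = l * complex_of_real (poly2 f (Re z) (Im z))"
  shows "l \<noteq> 0"
proof
  assume "l = 0"
  with l have "complex_of_real (poly2 g (Re (h z)) (Im (h z))) = 0" for z by simp
  hence "poly2 g (Re w) (Im w) = 0" for w
    using h by (metis of_real_eq_0_iff surjD)
  hence "poly2 g x y = 0" for x y by (metis complex.sel)
  hence "g = 0" by (simp add: poly2_eq_iff)
  with g show False by simp
qed

text \<open>Stated through the real coordinates \<open>X\<close> and \<open>Y\<close> of
  \<open>h\<close>, so that it serves both orientations.\<close>

lemma real_curve_affine_image_iff:
  fixes f g :: "real poly poly" and h :: "complex \<Rightarrow> complex"
  assumes f: "irreducible f" and g: "g \<noteq> 0"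
    and deg: "total_degree g = total_degree f"
    and inf: "infinite (real_curve f)"
    and h: "bij h"
    and X: "total_degree X \<le> 1" "\<And>z. Re (h z) = poly2 X (Re z) (Im z)"
    and Y: "total_degree Y \<le> 1" "\<And>z. Im (h z) = poly2 Y (Re z) (Im z)"
  shows "h ` real_curve f = real_curve g \<longleftrightarrow>
    (\<exists>l. \<forall>z. complex_of_real (poly2 g (Re (h z)) (Im (h z))) = l * complex_of_real (poly2 f (Re z) (Im z)))"
    (is "?image \<longleftrightarrow> (\<exists>l. ?prop l)")
proof
  assume image: ?image
  define k where "k = subst2 g X Y"
  have k: "poly2 k (Re z) (Im z) = poly2 g (Re (h z)) (Im (h z))" for z
    by (simp add: k_def poly2_subst2 X Y)
  have "poly2 k (Re z) (Im z) = 0" if "z \<in> real_curve f" for z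
  proof -
    have "h z \<in> real_curve g" using image that by blast
    thus ?thesis by (simp add: real_curve_def k)
  qed
  hence "(\<lambda>z. (Re z, Im z)) ` real_curve f \<subseteq> {(x, y). poly2 f x y = 0 \<and> poly2 k x y = 0}"
    by (auto simp: real_curve_def)
  moreover have "infinite ((\<lambda>z. (Re z, Im z)) ` real_curve f)"
    using inf by (subst finite_image_iff) (auto simp: inj_on_def complex_eq_iff)
  ultimately have "f dvd k"
    using irreducible_dvd_if_infinite_common_zeros[OF f] finite_subset by blast
  then obtain q where q: "k = f * q" by auto
  \<comment> \<open>The quotient may still be 0 at this point; the convention for the zero
    polynomial covers that case.\<close>
  have "total_degree q = 0"
  proof (cases "q = 0")
    case True
    thus ?thesis using total_degree_0_iff[of "0 :: real poly poly"] by (metis pCons_0_0)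
  next
    case False
    moreover have "f \<noteq> 0" using f by auto
    moreover have "total_degree k \<le> total_degree f"
      using total_degree_subst2_affine[OF X(1) Y(1), of g] by (simp add: k_def deg)
    ultimately show ?thesis using q total_degree_mult[of f q] by simp
  qed
  then obtain c where "q = [:[:c:]:]" by (auto simp: total_degree_0_iff)
  hence "?prop (complex_of_real c)" using k q by (simp flip: k)
  thus "\<exists>l. ?prop l" ..
next
  assume "\<exists>l. ?prop l"
  then obtain l where l: "?prop l" ..
  have "l \<noteq> 0" using nonzero_multiplier[OF g bij_is_surj[OF h]] l by blast
  have "h z \<in> real_curve g \<longleftrightarrow> z \<in> real_curve f" for z
  proof -
    have "h z \<in> real_curve g \<longleftrightarrow> complex_of_real (poly2 g (Re (h z)) (Im (h z))) = 0"
      by (simp add: real_curve_def)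
    also have "\<dots> \<longleftrightarrow> z \<in> real_curve f"
      using \<open>l \<noteq> 0\<close> l by (simp add: real_curve_def)
    finally show ?thesis .
  qed
  \<comment> \<open>By surjectivity, the image of a preimage is the set itself.\<close>
  hence "real_curve f = h -` real_curve g" by auto
  thus ?image using bij_is_surj[OF h] by (simp add: surj_image_vimage_eq)
qed

theorem theorem1:
  fixes f g :: "real poly poly" and n :: nat and a b :: complex
  assumes "irreducible f" and "irreducible g"
    and "total_degree f = n" and "total_degree g = n"
    and "rational_coeffs f" and "rational_coeffs g"
    and "infinite (real_curve f)" and "infinite (real_curve g)"
    and "\<not> is_line (real_curve f)" and "\<not> is_line (real_curve g)"
    and "\<not> is_circle (real_curve f)" and "\<not> is_circle (real_curve g)"
    and "a \<noteq> 0"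
  shows "((\<lambda>z. a * z + b) ` real_curve f = real_curve g \<longleftrightarrow>
            (\<exists>l::complex. l \<noteq> 0 \<and>
               (\<forall>z. poly2 (complex_implicit g) (a * z + b) (cnj a * cnj z + cnj b)
                  = l * poly2 (complex_implicit f) z (cnj z))))
       \<and> ((\<lambda>z. a * cnj z + b) ` real_curve f = real_curve g \<longleftrightarrow>
            (\<exists>l::complex.
               (\<forall>z. poly2 (complex_implicit g) (a * cnj z + b) (cnj a * z + cnj b)
                  = l * poly2 (complex_implicit f) z (cnj z))))"
proof -
  have g: "g \<noteq> 0" using assms by auto
  have deg: "total_degree g = total_degree f" using assms by simp
  have affine: "total_degree [:[:p, q:], [:r:]:] \<le> 1" for p q r :: real
    by (subst total_degree_le_iff) (auto simp: coeff_pCons split: nat.splits)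
  have bij_preserving: "bij (\<lambda>z. a * z + b)"
    using \<open>a \<noteq> 0\<close> by (intro bij_betwI[where g = "\<lambda>w. (w - b) / a"]) auto
  have bij_reversing: "bij (\<lambda>z. a * cnj z + b)"
    using \<open>a \<noteq> 0\<close> by (intro bij_betwI[where g = "\<lambda>w. cnj ((w - b) / a)"]) auto
  \<comment> \<open>The two arguments are conjugate to each other, so the value is that of
    \<open>g\<close> at the image point.\<close>
  have G: "poly2 (complex_implicit g) (a * z + b) (cnj a * cnj z + cnj b)
      = complex_of_real (poly2 g (Re (a * z + b)) (Im (a * z + b)))" for z
    using complex_implicit_cnj[of g "a * z + b"] by simp
  have G': "poly2 (complex_implicit g) (a * cnj z + b) (cnj a * z + cnj b)
      = complex_of_real (poly2 g (Re (a * cnj z + b)) (Im (a * cnj z + b)))" for z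
    using complex_implicit_cnj[of g "a * cnj z + b"] by simp
  \<comment> \<open>For z = x + iy the coordinates of the image are Re b + x Re a - y Im a and Im b
    + x Im a + y Re a; conjugating z flips the sign of the y terms.\<close>
  have preserving: "(\<lambda>z. a * z + b) ` real_curve f = real_curve g \<longleftrightarrow>
      (\<exists>l. \<forall>z. complex_of_real (poly2 g (Re (a * z + b)) (Im (a * z + b)))
        = l * complex_of_real (poly2 f (Re z) (Im z)))"
    by (rule real_curve_affine_image_iff[OF assms(1) g deg assms(7) bij_preserving
          affine[of "Re b" "Re a" "- Im a"] _ affine[of "Im b" "Im a" "Re a"]])
       (simp_all add: algebra_simps)
  have reversing: "(\<lambda>z. a * cnj z + b) ` real_curve f = real_curve g \<longleftrightarrow>
      (\<exists>l. \<forall>z. complex_of_real (poly2 g (Re (a * cnj z + b)) (Im (a * cnj z + b)))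
        = l * complex_of_real (poly2 f (Re z) (Im z)))"
    by (rule real_curve_affine_image_iff[OF assms(1) g deg assms(7) bij_reversing
          affine[of "Re b" "Re a" "Im a"] _ affine[of "Im b" "Im a" "- Re a"]])
       (simp_all add: algebra_simps)
  show ?thesis
    unfolding G G' complex_implicit_cnj preserving reversing
    using nonzero_multiplier[OF g bij_is_surj[OF bij_preserving], of _ f] by blast
qed

end
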